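(* Let $(H,\langle\cdot,\cdot\rangle_H)$ be a real Hilbert space with norm $\|\cdot\|$, let $P$ be the orthogonal projection of $H$ onto an arbitrary closed subspace of $H$, and let $P^{\perp}=\mathrm{Id}-P$. Then for all $x,y\in H$ the following three inequalities hold: $$|2\langle Px,y\rangle_H-\langle x,y\rangle_H|\leq D(x,y|P),$$ $$2|\langle Px,y\rangle_H|\leq D(x,y|P)+|\langle x,y\rangle_H|,$$ $$|\langle x,y\rangle_H|\leq \|P^{\perp}x\|\,\|P^{\perp}y\|+|\langle Px,y\rangle_H|,$$ where $D(x,y|P)=\|Px\|\,\|Py\|+\|P^{\perp}x\|\,\|P^{\perp}y\|$.
   Context: For an orthogonal projection $P$ on a real Hilbert space $H$ (onto a closed subspace $V=PH$), with $P^{\perp}=\mathrm{Id}-P$, the decoupling function (D-function) associated with $P$ is the map $D(\cdot,\cdot|P):H\times H\to[0,\infty)$ defined by $D(x,y|P)=\|Px\|\,\|Py\|+\|P^{\perp}x\|\,\|P^{\perp}y\|$, i.e. the Euclidean inner product in $\mathbb{R}^2$ of the vectors $(\|Px\|,\|P^{\perp}x\|)$ and $(\|Py\|,\|P^{\perp}y\|)$. *)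

theory Defs
  imports "HOL-Analysis.Analysis"
begin

(* The library's closest_point is restricted to Heine-Borel (locally compact) spaces, so the
   orthogonal projection of a general Hilbert space onto V is characterised by the orthogonal
   decomposition x = P x + (x - P x). *)
definition is_orthogonal_projection ::
  "'a::{real_inner, complete_space} set \<Rightarrow> ('a \<Rightarrow> 'a) \<Rightarrow> bool" where
  "is_orthogonal_projection V P \<longleftrightarrow> (\<forall>x. P x \<in> V \<and> x - P x \<in> V\<^sup>\<bottom>)"

definition perp_proj :: "('a::real_inner \<Rightarrow> 'a) \<Rightarrow> 'a \<Rightarrow> 'a" where
  "perp_proj P = (\<lambda>x. x - P x)"

definition decoupling :: "('a::real_inner \<Rightarrow> 'a) \<Rightarrow> 'a \<Rightarrow> 'a \<Rightarrow> real" where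
  "decoupling P x y = norm (P x) * norm (P y) + norm (perp_proj P x) * norm (perp_proj P y)"

lemma is_orthogonal_projection_unique:
  assumes "subspace V" "is_orthogonal_projection V P" "is_orthogonal_projection V Q"
  shows "P = Q"
proof
  fix x
  let ?d = "P x - Q x"
  have V: "?d \<in> V"
    using assms by (auto simp: is_orthogonal_projection_def intro: subspace_diff)
  have "?d \<bullet> (x - P x) = 0" "?d \<bullet> (x - Q x) = 0"
    using V assms(2,3)
    by (auto simp: is_orthogonal_projection_def orthogonal_comp_def orthogonal_def)
  then have "?d \<bullet> ?d = 0"
    by (simp add: inner_diff_right)
  then show "P x = Q x" by simp
qed

end

theory Submission
  imports Defs
begin

text \<open>
  Since the ranges of \<open>P\<close> and \<open>P\<^sup>\<bottom>\<close> are orthogonal to each other, the inner product splits into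
  two blocks, \<open>x \<bullet> y = a + b\<close> with \<open>a = P x \<bullet> P y = P x \<bullet> y\<close> and \<open>b = P\<^sup>\<bottom> x \<bullet> P\<^sup>\<bottom> y\<close>. The quantity
  \<open>2 (P x \<bullet> y) - x \<bullet> y\<close> is then \<open>a - b\<close>, so all three inequalities are triangle inequalities for
  \<open>a\<close> and \<open>b\<close>, combined with the Cauchy--Schwarz inequality applied in each block separately.
\<close>

lemma inner_projection_left:
  assumes "is_orthogonal_projection V P"
  shows "P x \<bullet> y = P x \<bullet> P y"
proof -
  have "P x \<bullet> (y - P y) = 0"
    using assms
    by (auto simp: is_orthogonal_projection_def orthogonal_comp_def orthogonal_def)
  then show ?thesis
    by (simp add: inner_diff_right)
qed

lemma inner_eq_projection_plus_perp:
  assumes "is_orthogonal_projection V P"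
  shows "x \<bullet> y = P x \<bullet> y + perp_proj P x \<bullet> perp_proj P y"
  using inner_projection_left[OF assms, of x y] inner_projection_left[OF assms, of y x]
  by (simp add: perp_proj_def inner_diff_left inner_diff_right inner_commute)

theorem proposition2:
  fixes V :: "'a::{real_inner, complete_space} set"
    and P :: "'a \<Rightarrow> 'a"
    and x y :: 'a
  assumes "subspace V" and "closed V"
    and "is_orthogonal_projection V P"
  shows "\<bar>2 * (P x \<bullet> y) - x \<bullet> y\<bar> \<le> decoupling P x y
    \<and> 2 * \<bar>P x \<bullet> y\<bar> \<le> decoupling P x y + \<bar>x \<bullet> y\<bar>
    \<and> \<bar>x \<bullet> y\<bar> \<le> norm (perp_proj P x) * norm (perp_proj P y) + \<bar>P x \<bullet> y\<bar>"
proof -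
  have split: "x \<bullet> y = P x \<bullet> y + perp_proj P x \<bullet> perp_proj P y"
    using inner_eq_projection_plus_perp[OF assms(3)] .
  have range_block: "\<bar>P x \<bullet> y\<bar> \<le> norm (P x) * norm (P y)"
    using Cauchy_Schwarz_ineq2[of "P x" "P y"] inner_projection_left[OF assms(3), of x y] by simp
  have perp_block:
    "\<bar>perp_proj P x \<bullet> perp_proj P y\<bar> \<le> norm (perp_proj P x) * norm (perp_proj P y)"
    by (rule Cauchy_Schwarz_ineq2)
  show ?thesis
    using split range_block perp_block unfolding decoupling_def by linarith
qed

end
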